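(* Let $S\subseteq\mathbb{N}$ be a polynomially sparse set of squarefree numbers. Then the set of pairwise least common multiples $\{\mathrm{lcm}(n,n'): n\in S,\ n'\in S\}$ is polynomially sparse.
   Context: $\mathbb{N}$ denotes the positive integers. For $\beta\in(0,1)$, a set $S\subseteq\mathbb{N}$ of squarefree numbers is called $\beta$-polynomially sparse if $\#\{n\le x: n\in S\}\le x^{1-\beta+o(1)}$ as $x\to+\infty$. A set is polynomially sparse if it is $\beta$-polynomially sparse for some $\beta\in(0,1)$. *)

theory Defs
  imports Complex_Main "HOL-Computational_Algebra.Squarefree"
begin

text \<open>The function \<open>e\<close> below is the \<open>o(1)\<close> in the exponent. Positivity and squarefreeness
  belong to the notion, which is only applied to sets of squarefree positive integers.\<close>

definition beta_polynomially_sparse :: "real \<Rightarrow> nat set \<Rightarrow> bool" where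
  "beta_polynomially_sparse \<beta> S \<longleftrightarrow>
     (\<forall>n\<in>S. 0 < n \<and> squarefree n) \<and>
     (\<exists>e :: real \<Rightarrow> real. (e \<longlongrightarrow> 0) at_top \<and>
        (\<forall>\<^sub>F x :: real in at_top.
           real (card {n \<in> S. real n \<le> x}) \<le> x powr (1 - \<beta> + e x)))"

definition polynomially_sparse :: "nat set \<Rightarrow> bool" where
  "polynomially_sparse S \<longleftrightarrow> (\<exists>\<beta>. 0 < \<beta> \<and> \<beta> < 1 \<and> beta_polynomially_sparse \<beta> S)"

end

theory Submission
  imports Defs "HOL-Analysis.Infinite_Sum" "HOL-Analysis.Summation_Tests"
    "HOL-Real_Asymp.Real_Asymp"
begin

text \<open>Since \<open>lcm n n' \<le> n * n'\<close>, one of the two arguments is at least the square root of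
  \<open>lcm n n'\<close>. So every least common multiple \<open>L\<close> is a multiple of an element of \<open>S\<close> that is not
  much smaller than \<open>L\<close>, and such multiples are rare for any polynomially sparse \<open>S\<close>: those with a
  divisor \<open>n \<in> S\<close>, \<open>n \<ge> y\<close>, number at most \<open>\<Sum> x / n\<close> up to \<open>x\<close>, where \<open>n\<close> ranges over the
  elements of \<open>S\<close> that are at least \<open>y\<close>. By sparseness the Dirichlet series of \<open>S\<close> converges at
  some real \<open>s < 1\<close> (\<open>power_saving_imp_summable\<close>), so this tail is \<open>O(x * y powr (s - 1))\<close>
  (\<open>card_multiples_of_large_elements\<close>), which saves a power of \<open>x\<close> when \<open>y = x powr (1/4)\<close>. The
  least common multiples not captured in this way are below \<open>sqrt x\<close> and therefore negligible.\<close>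

text \<open>At the price of a smaller exponent the error function can be absorbed, which leaves a clean
  power saving.\<close>

lemma polynomially_sparse_iff_power_saving:
  "polynomially_sparse S \<longleftrightarrow>
     (\<forall>n\<in>S. 0 < n \<and> squarefree n) \<and>
     (\<exists>\<gamma>. 0 < \<gamma> \<and> \<gamma> < 1 \<and>
        (\<forall>\<^sub>F x :: real in at_top. real (card {n \<in> S. real n \<le> x}) \<le> x powr (1 - \<gamma>)))"
  (is "_ \<longleftrightarrow> ?sqf \<and> (\<exists>\<gamma>. 0 < \<gamma> \<and> \<gamma> < 1 \<and> ?saving \<gamma>)")
proof
  assume "polynomially_sparse S"
  then obtain \<beta> e where \<beta>: "0 < \<beta>" "\<beta> < 1" and "?sqf" and e: "(e \<longlongrightarrow> 0) at_top"
    and ev: "\<forall>\<^sub>F x :: real in at_top. real (card {n \<in> S. real n \<le> x}) \<le> x powr (1 - \<beta> + e x)"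
    unfolding polynomially_sparse_def beta_polynomially_sparse_def by blast
  have "\<forall>\<^sub>F x in at_top. e x < \<beta> / 2"
    using e \<beta> by (intro order_tendstoD) auto
  then have "?saving (\<beta> / 2)"
    using ev eventually_ge_at_top[of 1]
  proof eventually_elim
    case (elim x)
    have "x powr (1 - \<beta> + e x) \<le> x powr (1 - \<beta> / 2)"
      using elim by (intro powr_mono) auto
    with elim show ?case by linarith
  qed
  with \<open>?sqf\<close> \<beta> show "?sqf \<and> (\<exists>\<gamma>. 0 < \<gamma> \<and> \<gamma> < 1 \<and> ?saving \<gamma>)"
    by (intro conjI exI[of _ "\<beta> / 2"]) auto
next
  assume "?sqf \<and> (\<exists>\<gamma>. 0 < \<gamma> \<and> \<gamma> < 1 \<and> ?saving \<gamma>)"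
  then obtain \<gamma> where "?sqf" "0 < \<gamma>" "\<gamma> < 1" "?saving \<gamma>"
    by blast
  then show "polynomially_sparse S"
    unfolding polynomially_sparse_def beta_polynomially_sparse_def
    by (intro exI[of _ \<gamma>] conjI exI[of _ "\<lambda>_. 0"]) auto
qed

text \<open>The rank \<open>r n\<close> of \<open>n\<close> in \<open>S\<close> is the value at \<open>n\<close> of the counting function, so for
  large \<open>n\<close> the term \<open>n powr (-s)\<close> is at most \<open>r n powr (-s / c)\<close>. Different elements have different ranks, hence
  the series over \<open>S\<close> is dominated by the convergent series over all \<open>k\<close> of
  \<open>k powr (-s / c)\<close>.\<close>

lemma power_saving_imp_summable:
  fixes S :: "nat set"
  assumes count: "\<forall>\<^sub>F x :: real in at_top. real (card {n \<in> S. real n \<le> x}) \<le> x powr c"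
    and c: "0 < c" "c < s"
  shows "(\<lambda>n. real n powr (- s)) summable_on S"
proof -
  obtain X :: real where
    X: "\<And>x. x \<ge> X \<Longrightarrow> real (card {n \<in> S. real n \<le> x}) \<le> x powr c"
    using count unfolding eventually_at_top_linorder by blast
  define r where "r n = card {k \<in> S. k \<le> n}" for n
  let ?large = "{n \<in> S. real n \<ge> X}"
  have fin: "finite {k \<in> S. k \<le> n}" for n
    by (rule finite_subset[of _ "{..n}"]) auto
  have r_pos: "0 < r n" if "n \<in> S" for n
    unfolding r_def card_gt_0_iff using fin that by blast
  have "r m < r n" if "m < n" "n \<in> S" for m n
    unfolding r_def using that by (intro psubset_card_mono fin) force
  then have inj: "inj_on r ?large"
    by (intro inj_onI) (metis (mono_tags, lifting) mem_Collect_eq nat_neq_iff)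
  have "summable (\<lambda>k. real k powr (- s / c))"
    unfolding summable_real_powr_iff using c by (simp add: field_simps)
  then have "(\<lambda>k. real k powr (- s / c)) summable_on UNIV"
    by (rule summable_nonneg_imp_summable_on) simp
  then have "(\<lambda>k. real k powr (- s / c)) summable_on r ` ?large"
    by (rule summable_on_subset_banach) simp
  then have "((\<lambda>k. real k powr (- s / c)) \<circ> r) summable_on ?large"
    by (simp only: summable_on_reindex[OF inj])
  then have "(\<lambda>n. real n powr (- s)) summable_on ?large"
  proof (rule summable_on_comparison_test)
    fix n assume n: "n \<in> ?large"
    have "real (r n) \<le> real n powr c"
      using X[of "real n"] n by (simp add: r_def)
    then have "(real n powr c) powr (- s / c) \<le> real (r n) powr (- s / c)"
      using r_pos n c by (intro powr_mono2') (auto simp: field_simps)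
    then show "real n powr (- s) \<le> ((\<lambda>k. real k powr (- s / c)) \<circ> r) n"
      using c by (simp add: powr_powr)
  qed simp
  moreover have "finite {n \<in> S. real n < X}"
    by (rule finite_subset[of _ "{..nat \<lceil>X\<rceil>}"]) (auto simp: le_nat_iff, linarith)
  ultimately have "(\<lambda>n. real n powr (- s)) summable_on (?large \<union> {n \<in> S. real n < X})"
    by (intro summable_on_union) auto
  also have "?large \<union> {n \<in> S. real n < X} = S"
    by auto
  finally show ?thesis .
qed

lemma card_multiples_le:
  fixes x :: real
  assumes "0 < n" "0 \<le> x"
  shows "real (card {m. 0 < m \<and> real m \<le> x \<and> n dvd m}) \<le> x / real n"
proof -
  have "{m. 0 < m \<and> real m \<le> x \<and> n dvd m} \<subseteq> (\<lambda>k. n * k) ` {1..nat \<lfloor>x / real n\<rfloor>}"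
  proof
    fix m assume m: "m \<in> {m. 0 < m \<and> real m \<le> x \<and> n dvd m}"
    then obtain k where k: "m = n * k" by (auto elim: dvdE)
    with m assms have "real k \<le> x / real n" "0 < k"
      by (auto simp: field_simps)
    with k show "m \<in> (\<lambda>k. n * k) ` {1..nat \<lfloor>x / real n\<rfloor>}"
      by (auto simp: le_nat_floor)
  qed
  then have "card {m. 0 < m \<and> real m \<le> x \<and> n dvd m} \<le> card {1..nat \<lfloor>x / real n\<rfloor>}"
    by (meson card_image_le card_mono finite_atLeastAtMost finite_imageI le_trans)
  also have "real \<dots> \<le> x / real n"
    using assms by simp
  finally show ?thesis by simp
qed

text \<open>A union bound over the divisors \<open>n\<close>, followed by Rankin's trick: for \<open>n \<ge> y\<close>, the
  term \<open>1 / n\<close> is at most \<open>y powr (s - 1) * n powr (- s)\<close>.\<close>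

lemma card_multiples_of_large_elements:
  fixes S :: "nat set" and x y :: real
  assumes pos: "\<And>n. n \<in> S \<Longrightarrow> 0 < n"
    and summable: "(\<lambda>n. real n powr (- s)) summable_on S"
    and s: "s \<le> 1" and x: "0 \<le> x" and y: "0 < y"
  shows "real (card {m. 0 < m \<and> real m \<le> x \<and> (\<exists>n\<in>S. y \<le> real n \<and> n dvd m)})
           \<le> x * y powr (s - 1) * (\<Sum>\<^sub>\<infinity>n\<in>S. real n powr (- s))"
proof -
  define D where "D = {n \<in> S. y \<le> real n \<and> real n \<le> x}"
  define M where "M n = {m. 0 < m \<and> real m \<le> x \<and> n dvd m}" for n :: nat
  have fin_le: "finite {m::nat. real m \<le> x}"
    by (rule finite_subset[of _ "{..nat \<lfloor>x\<rfloor>}"]) (auto simp: le_nat_floor)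
  have fin_D: "finite D"
    by (rule finite_subset[OF _ fin_le]) (auto simp: D_def)
  have fin_M: "finite (M n)" for n
    by (rule finite_subset[OF _ fin_le]) (auto simp: M_def)
  have "{m. 0 < m \<and> real m \<le> x \<and> (\<exists>n\<in>S. y \<le> real n \<and> n dvd m)} \<subseteq> (\<Union>n\<in>D. M n)"
  proof
    fix m assume "m \<in> {m. 0 < m \<and> real m \<le> x \<and> (\<exists>n\<in>S. y \<le> real n \<and> n dvd m)}"
    then obtain n where n: "0 < m" "real m \<le> x" "n \<in> S" "y \<le> real n" "n dvd m"
      by blast
    then have "real n \<le> x"
      using dvd_imp_le[of n m] by linarith
    with n show "m \<in> (\<Union>n\<in>D. M n)"
      by (auto simp: D_def M_def)
  qed
  then have "card {m. 0 < m \<and> real m \<le> x \<and> (\<exists>n\<in>S. y \<le> real n \<and> n dvd m)}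
               \<le> card (\<Union>n\<in>D. M n)"
    using fin_D fin_M by (intro card_mono) auto
  also have "\<dots> \<le> (\<Sum>n\<in>D. card (M n))"
    using fin_D by (rule card_UN_le)
  also have "real \<dots> \<le> (\<Sum>n\<in>D. x * y powr (s - 1) * real n powr (- s))"
    unfolding of_nat_sum
  proof (rule sum_mono)
    fix n assume n: "n \<in> D"
    then have n_pos: "0 < n" using pos by (simp add: D_def)
    have "real (card (M n)) \<le> x * (1 / real n)"
      using card_multiples_le[OF n_pos x] by (simp add: M_def)
    also have "1 / real n = real n powr (s - 1) * real n powr (- s)"
      using n_pos by (simp add: powr_diff powr_minus_divide)
    also have "x * \<dots> \<le> x * (y powr (s - 1) * real n powr (- s))"
      using n s x y by (intro mult_left_mono mult_right_mono powr_mono2') (auto simp: D_def)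
    finally show "real (card (M n)) \<le> x * y powr (s - 1) * real n powr (- s)"
      by (simp add: mult.assoc)
  qed
  also have "\<dots> = x * y powr (s - 1) * (\<Sum>n\<in>D. real n powr (- s))"
    by (simp add: sum_distrib_left)
  also have "\<dots> \<le> x * y powr (s - 1) * (\<Sum>\<^sub>\<infinity>n\<in>S. real n powr (- s))"
    using x fin_D
    by (intro mult_left_mono finite_sum_le_infsum[OF summable]) (auto simp: D_def)
  finally show ?thesis by simp
qed

lemma squarefree_lcm:
  fixes a b :: nat
  assumes "squarefree a" "squarefree b"
  shows "squarefree (lcm a b)"
proof -
  have "a \<noteq> 0" "b \<noteq> 0"
    using assms not_squarefree_0 by metis+
  with assms show ?thesis
    by (auto simp: squarefree_factorial_semiring'' multiplicity_lcm lcm_eq_0_iff)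
qed

theorem mainTheorem4:
  fixes S :: "nat set"
  assumes "polynomially_sparse S"
  shows "polynomially_sparse {lcm n n' | n n'. n \<in> S \<and> n' \<in> S}"
proof -
  let ?T = "{lcm n n' | n n'. n \<in> S \<and> n' \<in> S}"
  obtain \<gamma> where \<gamma>: "0 < \<gamma>" "\<gamma> < 1" and S: "\<And>n. n \<in> S \<Longrightarrow> 0 < n \<and> squarefree n"
    and saving: "\<forall>\<^sub>F x :: real in at_top. real (card {n \<in> S. real n \<le> x}) \<le> x powr (1 - \<gamma>)"
    using assms unfolding polynomially_sparse_iff_power_saving by blast
  define s where "s = 1 - \<gamma> / 2"
  define K where "K = (\<Sum>\<^sub>\<infinity>n\<in>S. real n powr (- s))"
  have summable: "(\<lambda>n. real n powr (- s)) summable_on S"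
    using saving \<gamma> by (intro power_saving_imp_summable[where c = "1 - \<gamma>"]) (auto simp: s_def)
  have T: "0 < m \<and> squarefree m" if "m \<in> ?T" for m
    using that S by (auto intro: squarefree_lcm simp: lcm_pos_nat)
  have large_divisor: "\<exists>n\<in>S. sqrt (real m) \<le> real n \<and> n dvd m" if m: "m \<in> ?T" for m
  proof -
    obtain a b where ab: "m = lcm a b" "a \<in> S" "b \<in> S"
      using m by blast
    have "m \<le> a * b"
      using ab S by (auto intro!: dvd_imp_le)
    also have "a * b \<le> max a b * max a b"
      by (intro mult_mono) auto
    finally have "real m \<le> (real (max a b))\<^sup>2"
      by (metis of_nat_le_iff of_nat_power power2_eq_square)
    then have "sqrt (real m) \<le> real (max a b)"
      by (intro real_le_lsqrt) auto
    with ab show ?thesis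
      by (intro bexI[of _ "max a b"]) (auto simp: max_def)
  qed
  have count: "real (card {m \<in> ?T. real m \<le> x})
                 \<le> sqrt x + x * (x powr (1/4)) powr (s - 1) * K" if x: "1 \<le> x" for x
  proof -
    let ?small = "{1..nat \<lfloor>sqrt x\<rfloor>}"
    let ?large = "{m. 0 < m \<and> real m \<le> x \<and> (\<exists>n\<in>S. x powr (1/4) \<le> real n \<and> n dvd m)}"
    have "{m \<in> ?T. real m \<le> x} \<subseteq> ?small \<union> ?large"
    proof
      fix m assume m: "m \<in> {m \<in> ?T. real m \<le> x}"
      show "m \<in> ?small \<union> ?large"
      proof (cases "real m \<le> sqrt x")
        case True
        with m T[of m] show ?thesis
          by (auto simp: le_nat_floor)
      next
        case False
        have "x powr (1/4) = sqrt (sqrt x)"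
          using x by (simp add: powr_half_sqrt[symmetric] powr_powr)
        also have "\<dots> \<le> sqrt (real m)"
          using False by simp
        finally have y: "x powr (1/4) \<le> sqrt (real m)" .
        obtain n where "n \<in> S" "sqrt (real m) \<le> real n" "n dvd m"
          using m large_divisor by blast
        with y have "\<exists>n\<in>S. x powr (1/4) \<le> real n \<and> n dvd m"
          by (intro bexI[of _ n]) linarith+
        with m T[of m] show ?thesis
          by simp
      qed
    qed
    moreover have "finite ?large"
      by (rule finite_subset[of _ "{..nat \<lfloor>x\<rfloor>}"]) (auto simp: le_nat_floor)
    ultimately have "card {m \<in> ?T. real m \<le> x} \<le> card (?small \<union> ?large)"
      by (intro card_mono) auto
    also have "\<dots> \<le> card ?small + card ?large"
      by (rule card_Un_le)
    finally have "real (card {m \<in> ?T. real m \<le> x}) \<le> real (card ?small) + real (card ?large)"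
      by linarith
    moreover have "real (card ?small) \<le> sqrt x"
      using x by simp
    moreover have "real (card ?large) \<le> x * (x powr (1/4)) powr (s - 1) * K"
      unfolding K_def using S summable x \<gamma>
      by (intro card_multiples_of_large_elements) (auto simp: s_def)
    ultimately show ?thesis by linarith
  qed
  \<comment> \<open>The second summand has order \<open>x powr (1 - \<gamma> / 8)\<close>; half of this saving absorbs \<open>K\<close>.\<close>
  have "\<forall>\<^sub>F x :: real in at_top.
          sqrt x + x * (x powr (1/4)) powr (s - 1) * K \<le> x powr (1 - \<gamma> / 16)"
    unfolding s_def using \<gamma> by real_asymp
  then have "\<forall>\<^sub>F x :: real in at_top.
               real (card {m \<in> ?T. real m \<le> x}) \<le> x powr (1 - \<gamma> / 16)"
    using eventually_ge_at_top[of 1] by eventually_elim (use count order_trans in blast)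
  then show ?thesis
    unfolding polynomially_sparse_iff_power_saving using T \<gamma>
    by (intro conjI ballI exI[of _ "\<gamma> / 16"]) auto
qed

end
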